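(* For every $\alpha>0$, the even function $x\mapsto x^\alpha K_\alpha(x)$ is strictly positive definite on $\mathbb{R}$.
   Context: $K_\alpha$ is the modified Bessel function of the second kind, $K_\alpha(x)=\int_0^{\infty}e^{-x\cosh t}\cosh(\alpha t)\,dt$ for $x>0$. The even function $x^\alpha K_\alpha(x)$ on $\mathbb{R}$ is understood as $x\mapsto |x|^\alpha K_\alpha(|x|)$ for $x\ne0$, extended by continuity at $x=0$ (with value $2^{\alpha-1}\Gamma(\alpha)$). A continuous function $f:\mathbb{R}\to\mathbb{C}$ is strictly positive definite on $\mathbb{R}$ if for every $N\ge1$, all pairwise distinct real numbers $x_1,\dots,x_N$ and all complex numbers $z_1,\dots,z_N$ not all zero, $\sum_{j=1}^N\sum_{k=1}^N z_j\overline{z_k}f(x_j-x_k)>0$. *)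

theory Defs
  imports "HOL-Analysis.Analysis"
begin

definition bessel_K :: "real \<Rightarrow> real \<Rightarrow> real" where
  "bessel_K \<alpha> x = (LBINT t:{0..}. exp (- x * cosh t) * cosh (\<alpha> * t))"

(* The value at 0 is the limit of the other branch as x tends to 0, for \<alpha> > 0. *)
definition even_power_bessel_K :: "real \<Rightarrow> real \<Rightarrow> real" where
  "even_power_bessel_K \<alpha> x =
     (if x = 0 then 2 powr (\<alpha> - 1) * Gamma \<alpha> else \<bar>x\<bar> powr \<alpha> * bessel_K \<alpha> \<bar>x\<bar>)"

(* Positivity of a complex number means that it is real and its real part is positive. *)
definition strictly_positive_definite :: "(real \<Rightarrow> complex) \<Rightarrow> bool" where
  "strictly_positive_definite f \<longleftrightarrow>
     continuous_on UNIV f \<and>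
     (\<forall>(N::nat) (x :: nat \<Rightarrow> real) (z :: nat \<Rightarrow> complex).
        N \<ge> 1 \<longrightarrow> inj_on x {1..N} \<longrightarrow> (\<exists>j\<in>{1..N}. z j \<noteq> 0) \<longrightarrow>
          (\<Sum>j=1..N. \<Sum>k=1..N. z j * cnj (z k) * f (x j - x k)) \<in> \<real> \<and>
          Re (\<Sum>j=1..N. \<Sum>k=1..N. z j * cnj (z k) * f (x j - x k)) > 0)"

end

theory Submission
  imports Defs
begin

text \<open>
  The function is a mixture of Gaussians with a strictly positive weight:

  \<open>even_power_bessel_K \<alpha> x = 2 powr (\<alpha> - 1) *
    (LBINT u:{0<..}. u powr (\<alpha> - 1) * exp (- u - x\<^sup>2 / (4 * u)))\<close>.

  For \<open>x > 0\<close> this is the substitution \<open>t = ln (2 * u / x)\<close> in the integral of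
  \<open>exp (- x * cosh t + \<alpha> * t)\<close> over the whole line, which is \<open>2 * bessel_K \<alpha> x\<close>; both sides are even in \<open>x\<close>.
  At \<open>x = 0\<close> the right-hand side is the Gamma integral, so the prescribed value there needs no limit
  argument, and the integrand of \<open>Gamma \<alpha>\<close> dominates the integrand for every \<open>x\<close>. Dominated
  convergence therefore gives continuity
  (\<open>even_power_bessel_K_eq_gaussian_mixture\<close>, \<open>continuous_gaussian_mixture\<close>).

  A quadratic form of the mixture is the integral over \<open>u\<close> of the quadratic forms of the Gaussians
  \<open>exp (- d\<^sup>2 / (4 * u))\<close>, and an integral of a strictly positive function is strictly positive.
  So everything reduces to strict positive definiteness of a single Gaussian
  (\<open>gaussian_strictly_positive_definite\<close>). That has an elementary proof without Fourier transforms: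
  writing \<open>exp (- c * (x - y)\<^sup>2) = exp (- c * x\<^sup>2) * exp (- c * y\<^sup>2) * exp (2 * c * x * y)\<close> and expanding
  the last factor in its power series turns the quadratic form into a series of squares of
  moments \<open>\<Sum>j. w j * x j ^ n\<close> with positive coefficients. All moments vanish only when all the
  weights do (\<open>weights_zero_if_moments_zero\<close>).
\<close>

section \<open>Quadratic forms of Gaussians\<close>

text \<open>
  Vanishing moments make the weighted sum of every polynomial over the nodes vanish; the polynomial
  that is zero at all nodes except \<open>x j\<close> then isolates \<open>w j\<close>.
\<close>

lemma weights_zero_if_moments_zero:
  fixes x w :: "'i \<Rightarrow> 'a :: idom"
  assumes "finite S" "inj_on x S"
    and moments: "\<And>n. (\<Sum>j\<in>S. w j * x j ^ n) = 0"
    and "j \<in> S"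
  shows "w j = 0"
proof -
  have poly_moment: "(\<Sum>i\<in>S. w i * poly p (x i)) = 0" for p
  proof -
    have "(\<Sum>i\<in>S. w i * poly p (x i)) = (\<Sum>i\<in>S. \<Sum>n\<le>degree p. coeff p n * (w i * x i ^ n))"
      by (simp add: poly_altdef sum_distrib_left mult_ac)
    also have "\<dots> = (\<Sum>n\<le>degree p. coeff p n * (\<Sum>i\<in>S. w i * x i ^ n))"
      by (subst sum.swap) (simp add: sum_distrib_left)
    finally show ?thesis
      by (simp add: moments)
  qed
  define p where "p = (\<Prod>k\<in>S - {j}. [:- x k, 1:])"
  have p_node: "poly p (x i) = 0" if "i \<in> S - {j}" for i
    using that \<open>finite S\<close> by (auto simp: p_def poly_prod)
  have "x j \<noteq> x k" if "k \<in> S - {j}" for k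
    using that assms(2,4) by (auto dest: inj_onD)
  then have "poly p (x j) \<noteq> 0"
    using \<open>finite S\<close> by (auto simp: p_def poly_prod)
  moreover have "w j * poly p (x j) = 0"
    using poly_moment[of p] p_node by (simp add: sum.remove[OF assms(1,4)])
  ultimately show ?thesis
    by simp
qed

text \<open>
  The kernel \<open>exp (2 * c * x * y)\<close> has a power series with positive coefficients in \<open>x * y\<close>, hence its
  quadratic form is a series of squares; the Gaussian kernel differs from it only by the factors
  \<open>exp (- c * x\<^sup>2)\<close> and \<open>exp (- c * y\<^sup>2)\<close>, which are absorbed into the weights.
\<close>

lemma gaussian_strictly_positive_definite:
  fixes x a :: "'i \<Rightarrow> real"
  assumes "finite S" "inj_on x S" "c > 0" "j \<in> S" "a j \<noteq> 0"
  shows "(\<Sum>i\<in>S. \<Sum>k\<in>S. a i * a k * exp (- c * (x i - x k)\<^sup>2)) > 0"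
proof -
  define w where "w i = a i * exp (- c * (x i)\<^sup>2)" for i
  define t where "t n = (2 * c) ^ n / fact n * (\<Sum>i\<in>S. w i * x i ^ n)\<^sup>2" for n
  have gauss: "a i * a k * exp (- c * (x i - x k)\<^sup>2) = w i * w k * exp (2 * c * x i * x k)" for i k
    by (simp add: w_def mult_ac flip: exp_add) (simp add: algebra_simps power2_eq_square)
  have "(\<lambda>n. (2 * c * x i * x k) ^ n / fact n) sums exp (2 * c * x i * x k)" for i k
    using exp_converges[of "2 * c * x i * x k"] by (simp add: divide_inverse mult_ac)
  then have "(\<lambda>n. \<Sum>i\<in>S. \<Sum>k\<in>S. w i * w k * ((2 * c * x i * x k) ^ n / fact n))
      sums (\<Sum>i\<in>S. \<Sum>k\<in>S. w i * w k * exp (2 * c * x i * x k))"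
    by (intro sums_sum sums_mult)
  also have "(\<lambda>n. \<Sum>i\<in>S. \<Sum>k\<in>S. w i * w k * ((2 * c * x i * x k) ^ n / fact n)) = t"
    by (auto simp: t_def fun_eq_iff power2_eq_square sum_product sum_distrib_left
        power_mult_distrib mult_ac intro!: sum.cong)
  finally have t_sums: "t sums (\<Sum>i\<in>S. \<Sum>k\<in>S. a i * a k * exp (- c * (x i - x k)\<^sup>2))"
    by (simp only: gauss)
  have t_nonneg: "t n \<ge> 0" for n
    using \<open>c > 0\<close> by (simp add: t_def)
  \<comment> \<open>The weight at \<open>j\<close> survives the rescaling, so some moment is nonzero, and its square makes
      the series positive.\<close>
  have "w j \<noteq> 0"
    using assms by (simp add: w_def)
  then obtain n where "(\<Sum>i\<in>S. w i * x i ^ n) \<noteq> 0"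
    using weights_zero_if_moments_zero[OF assms(1,2) _ assms(4), of w] by auto
  then have "t n > 0"
    using \<open>c > 0\<close> by (simp add: t_def)
  then have "suminf t > 0"
    using t_sums t_nonneg by (meson sums_summable suminf_pos2)
  then show ?thesis
    using t_sums by (simp add: sums_iff)
qed

text \<open>
  For real even \<open>f\<close> the Hermitian form is real, and at \<open>z = a + \<i> b\<close> it splits into the real quadratic
  forms at \<open>a\<close> and at \<open>b\<close>, because \<open>Re (z j * cnj (z k)) = a j * a k + b j * b k\<close>.
\<close>

lemma strictly_positive_definite_of_real:
  fixes f :: "real \<Rightarrow> real"
  assumes cont: "continuous_on UNIV f"
    and even: "\<And>x. f (- x) = f x"
    and pos: "\<And>(S :: nat set) x a j. finite S \<Longrightarrow> inj_on x S \<Longrightarrow> j \<in> S \<Longrightarrow> a j \<noteq> 0 \<Longrightarrow>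
      (\<Sum>i\<in>S. \<Sum>k\<in>S. a i * a k * f (x i - x k)) > 0"
  shows "strictly_positive_definite (\<lambda>x. complex_of_real (f x))"
  unfolding strictly_positive_definite_def
proof (intro conjI allI impI)
  show "continuous_on UNIV (\<lambda>x. complex_of_real (f x))"
    using cont by (intro continuous_intros)
next
  fix N :: nat and x :: "nat \<Rightarrow> real" and z :: "nat \<Rightarrow> complex"
  assume inj: "inj_on x {1..N}" and nz: "\<exists>j\<in>{1..N}. z j \<noteq> 0"
  let ?Q = "\<lambda>a. \<Sum>j=1..N. \<Sum>k=1..N. a j * a k * f (x j - x k)"
  let ?Z = "\<Sum>j=1..N. \<Sum>k=1..N. z j * cnj (z k) * of_real (f (x j - x k))"
  have f_diff_commute: "f (u - v) = f (v - u)" for u v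
    using even[of "u - v"] by simp
  have "cnj ?Z = (\<Sum>j=1..N. \<Sum>k=1..N. cnj (z j) * z k * of_real (f (x j - x k)))"
    by simp
  also have "\<dots> = (\<Sum>j=1..N. \<Sum>k=1..N. cnj (z k) * z j * of_real (f (x k - x j)))"
    by (rule sum.swap)
  also have "\<dots> = ?Z"
    by (intro sum.cong refl) (simp add: f_diff_commute mult_ac)
  finally show "?Z \<in> \<real>"
    by (simp add: Reals_cnj_iff)
  have Re_Z: "Re ?Z = ?Q (\<lambda>j. Re (z j)) + ?Q (\<lambda>j. Im (z j))"
    by (simp add: sum.distrib algebra_simps)
  have Q_pos: "?Q a > 0" if "\<exists>j\<in>{1..N}. a j \<noteq> 0" for a :: "nat \<Rightarrow> real"
    using that pos[OF _ inj] by blast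
  have Q_nonneg: "?Q a \<ge> 0" for a :: "nat \<Rightarrow> real"
    using Q_pos[of a] by (cases "\<exists>j\<in>{1..N}. a j \<noteq> 0") auto
  from nz have "(\<exists>j\<in>{1..N}. Re (z j) \<noteq> 0) \<or> (\<exists>j\<in>{1..N}. Im (z j) \<noteq> 0)"
    by (auto simp: complex_eq_iff)
  then show "Re ?Z > 0"
  proof
    assume "\<exists>j\<in>{1..N}. Re (z j) \<noteq> 0"
    then show ?thesis
      unfolding Re_Z using Q_nonneg[of "\<lambda>j. Im (z j)"] by (intro add_pos_nonneg Q_pos)
  next
    assume "\<exists>j\<in>{1..N}. Im (z j) \<noteq> 0"
    then show ?thesis
      unfolding Re_Z using Q_nonneg[of "\<lambda>j. Re (z j)"] by (intro add_nonneg_pos Q_pos)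
  qed
qed

section \<open>Mixtures of Gaussians with Gamma weight\<close>

text \<open>
  Averaging \<open>exp (- x\<^sup>2 / (4 * u))\<close> against the unnormalised Gamma density in \<open>u\<close>. Unlike
  the integral of \<open>exp (- x * cosh t) * cosh (\<alpha> * t)\<close>, this one converges at \<open>x = 0\<close> too, for every \<open>\<alpha> > 0\<close>.
\<close>

definition gaussian_mixture :: "real \<Rightarrow> real \<Rightarrow> real" where
  "gaussian_mixture \<alpha> x = (LBINT u:{0<..}. u powr (\<alpha> - 1) * exp (- u - x\<^sup>2 / (4 * u)))"

lemma has_integral_Gamma_Ioi:
  fixes \<alpha> :: real
  assumes "\<alpha> > 0"
  shows "((\<lambda>u. u powr (\<alpha> - 1) * exp (- u)) has_integral Gamma \<alpha>) {0<..}"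
proof -
  have "((\<lambda>u. u powr (\<alpha> - 1) * exp (- u)) has_integral Gamma \<alpha>) {0..}"
    using Gamma_integral_real[OF assms] by (simp add: exp_minus field_simps)
  then show ?thesis
    by (rule has_integral_spike_set_eq[THEN iffD1, rotated -1])
      (auto intro: negligible_subset[of "{0}"])
qed

lemma set_integrable_Gamma_integrand:
  fixes \<alpha> :: real
  assumes "\<alpha> > 0"
  shows "set_integrable lborel {0<..} (\<lambda>u. u powr (\<alpha> - 1) * exp (- u))"
proof -
  let ?f = "\<lambda>u::real. u powr (\<alpha> - 1) * exp (- u)"
  have "?f absolutely_integrable_on {0<..}"
    using has_integral_Gamma_Ioi[OF assms]
    by (intro nonnegative_absolutely_integrable_1) (auto simp: integrable_on_def)
  then have "integrable (completion lborel) (\<lambda>u. indicator {0<..} u *\<^sub>R ?f u)"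
    by (simp only: set_integrable_def)
  then have "integrable lborel (\<lambda>u. indicator {0<..} u *\<^sub>R ?f u)"
    by (subst (asm) integrable_completion) measurable
  then show ?thesis
    by (simp only: set_integrable_def)
qed

lemma gaussian_mixture_0:
  assumes "\<alpha> > 0"
  shows "gaussian_mixture \<alpha> 0 = Gamma \<alpha>"
  using set_borel_integral_eq_integral(2)[OF set_integrable_Gamma_integrand[OF assms]]
    has_integral_Gamma_Ioi[OF assms]
  by (simp add: gaussian_mixture_def integral_unique)

lemma set_integrable_gaussian_mixture:
  fixes \<alpha> x :: real
  assumes "\<alpha> > 0"
  shows "set_integrable lborel {0<..} (\<lambda>u. u powr (\<alpha> - 1) * exp (- u - x\<^sup>2 / (4 * u)))"
proof (rule set_integrable_bound[OF set_integrable_Gamma_integrand[OF assms]])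
  show "AE u in lborel. u \<in> {0<..} \<longrightarrow> norm (u powr (\<alpha> - 1) * exp (- u - x\<^sup>2 / (4 * u)))
      \<le> norm (u powr (\<alpha> - 1) * exp (- u))"
    by (auto simp: abs_mult intro!: AE_I2 mult_left_mono)
qed (simp add: set_borel_measurable_def)

lemma continuous_gaussian_mixture:
  fixes \<alpha> :: real
  assumes "\<alpha> > 0"
  shows "continuous_on UNIV (gaussian_mixture \<alpha>)"
proof (clarsimp simp: continuous_on_sequentially o_def)
  fix y :: "nat \<Rightarrow> real" and x
  assume y: "y \<longlonglongrightarrow> x"
  show "(\<lambda>n. gaussian_mixture \<alpha> (y n)) \<longlonglongrightarrow> gaussian_mixture \<alpha> x"
    unfolding gaussian_mixture_def set_lebesgue_integral_def
  proof (rule integral_dominated_convergence)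
    show "integrable lborel (\<lambda>u. indicator {0<..} u *\<^sub>R (u powr (\<alpha> - 1) * exp (- u)))"
      using set_integrable_Gamma_integrand[OF assms] by (simp add: set_integrable_def)
    show "AE u in lborel. (\<lambda>n. indicator {0<..} u *\<^sub>R (u powr (\<alpha> - 1) * exp (- u - (y n)\<^sup>2 / (4 * u))))
        \<longlonglongrightarrow> indicator {0<..} u *\<^sub>R (u powr (\<alpha> - 1) * exp (- u - x\<^sup>2 / (4 * u)))"
    proof (rule AE_I2)
      fix u :: real
      show "(\<lambda>n. indicator {0<..} u *\<^sub>R (u powr (\<alpha> - 1) * exp (- u - (y n)\<^sup>2 / (4 * u))))
          \<longlonglongrightarrow> indicator {0<..} u *\<^sub>R (u powr (\<alpha> - 1) * exp (- u - x\<^sup>2 / (4 * u)))"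
      proof (cases "u > 0")
        case True
        then show ?thesis
          by (intro tendsto_intros y) auto
      qed simp
    qed
    show "AE u in lborel. norm (indicator {0<..} u *\<^sub>R (u powr (\<alpha> - 1) * exp (- u - (y n)\<^sup>2 / (4 * u))))
        \<le> indicator {0<..} u *\<^sub>R (u powr (\<alpha> - 1) * exp (- u))" for n
      by (auto simp: indicator_def abs_mult intro!: AE_I2 mult_left_mono)
  qed auto
qed

lemma set_integral_pos_Ioi:
  fixes f :: "real \<Rightarrow> real"
  assumes int: "set_integrable lborel {0<..} f" and pos: "\<And>u. u > 0 \<Longrightarrow> f u > 0"
  shows "(LBINT u:{0<..}. f u) > 0"
proof -
  let ?g = "\<lambda>u. indicator {0<..} u *\<^sub>R f u"
  have int': "integrable lborel ?g"
    using int by (simp add: set_integrable_def)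
  have nonneg: "?g u \<ge> 0" for u
    using pos[of u] by (cases "u > 0") (auto simp: less_imp_le)
  have "(LBINT u. ?g u) \<noteq> 0"
  proof
    assume "(LBINT u. ?g u) = 0"
    then have "AE u in lborel. ?g u = 0"
      using int' nonneg by (subst (asm) integral_nonneg_eq_0_iff_AE) auto
    \<comment> \<open>Any subset of \<open>{0<..}\<close> of positive measure would give the contradiction.\<close>
    then have "AE u in lborel. u \<notin> {0<..<1::real}"
      by eventually_elim (use pos in \<open>force simp: indicator_def split: if_splits\<close>)
    then have "emeasure lborel {0<..<1::real} = 0"
      by (subst (asm) AE_iff_measurable[OF _ refl])
        (auto simp: greaterThanLessThan_def greaterThan_def lessThan_def Collect_conj_eq)
    then show False
      by simp
  qed
  moreover have "(LBINT u. ?g u) \<ge> 0"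
    using nonneg by (intro integral_nonneg_AE) auto
  ultimately show ?thesis
    by (simp add: set_lebesgue_integral_def)
qed

section \<open>The Bessel function as a mixture of Gaussians\<close>

text \<open>
  The substitution \<open>u = x / 2 * exp t\<close> turns \<open>x * cosh t\<close> into \<open>u + x\<^sup>2 / (4 * u)\<close>, \<open>exp (\<alpha> * t)\<close> into a
  multiple of \<open>u powr \<alpha>\<close> and \<open>dt\<close> into \<open>du / u\<close>. It is carried out from the \<open>u\<close> side, where
  integrability is known from the Gamma integral, so that integrability in \<open>t\<close> comes with it.
\<close>

lemma
  fixes x \<alpha> :: real
  assumes "x > 0" "\<alpha> > 0"
  shows set_integrable_exp_cosh: "set_integrable lborel UNIV (\<lambda>t. exp (- x * cosh t + \<alpha> * t))"
    and integral_exp_cosh: "(LBINT t:UNIV. exp (- x * cosh t + \<alpha> * t)) = (2 / x) powr \<alpha> * gaussian_mixture \<alpha> x"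
proof -
  define f where "f t = exp (- x * cosh t + \<alpha> * t)" for t
  define g where "g u = ln (2 * u / x)" for u
  have fg: "f (g u) * inverse u = (2 / x) powr \<alpha> * (u powr (\<alpha> - 1) * exp (- u - x\<^sup>2 / (4 * u)))"
    if "u > 0" for u
  proof -
    have cosh_g: "x * cosh (g u) = u + x\<^sup>2 / (4 * u)"
      using that \<open>x > 0\<close>
      by (simp add: g_def cosh_ln_real field_simps power2_eq_square)
    have "exp (\<alpha> * g u) = (2 / x) powr \<alpha> * u powr \<alpha>"
      using that \<open>x > 0\<close> by (simp add: g_def powr_def ln_mult ln_div ring_distribs flip: exp_add)
    moreover have "u powr \<alpha> * inverse u = u powr (\<alpha> - 1)"
      using that by (simp add: powr_diff divide_inverse)
    moreover have "f (g u) = exp (- u - x\<^sup>2 / (4 * u)) * exp (\<alpha> * g u)"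
      by (simp add: f_def cosh_g flip: exp_add)
    ultimately show ?thesis
      by (simp add: mult_ac)
  qed
  have fg_int: "set_integrable lborel {0<..} (\<lambda>u. f (g u) * inverse u)"
    by (subst set_integrable_cong[OF refl refl fg])
      (auto intro!: set_integrable_mult_right set_integrable_gaussian_mixture \<open>\<alpha> > 0\<close>)
  have lim0: "((ereal \<circ> g \<circ> real_of_ereal) \<longlongrightarrow> -\<infinity>) (at_right 0)"
  proof -
    have "filterlim g at_bot (at_right 0)"
      unfolding g_def
    proof (rule filterlim_compose[OF ln_at_0])
      have "((\<lambda>u. 2 * u / x) \<longlongrightarrow> 2 * 0 / x) (at_right 0)"
        using \<open>x > 0\<close> by (intro tendsto_intros) auto
      moreover have "\<forall>\<^sub>F u in at_right 0. 2 * u / x > 0"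
        using \<open>x > 0\<close> by (simp add: eventually_at_filter)
      ultimately show "filterlim (\<lambda>u. 2 * u / x) (at_right 0) (at_right 0)"
        by (auto simp: filterlim_at elim: eventually_mono)
    qed
    then show ?thesis
      by (auto simp: zero_ereal_def ereal_tendsto_simps simp del: zero_ereal_def[symmetric] ereal_eq_0)
  qed
  have lim_inf: "((ereal \<circ> g \<circ> real_of_ereal) \<longlongrightarrow> \<infinity>) (at_left \<infinity>)"
  proof -
    have "filterlim g at_top at_top"
      unfolding g_def
    proof (rule filterlim_compose[OF ln_at_top])
      show "filterlim (\<lambda>u. 2 * u / x) at_top at_top"
        using filterlim_tendsto_pos_mult_at_top[OF tendsto_const _ filterlim_ident, of "2 / x"] \<open>x > 0\<close>
        by (simp add: field_simps)
    qed
    then show ?thesis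
      by (auto simp: ereal_tendsto_simps)
  qed
  have Ioi: "einterval 0 \<infinity> = {0<..}"
    by (auto simp: einterval_def)
  have deriv: "(g has_real_derivative inverse u) (at u)" if "u > 0" for u
    unfolding g_def using that \<open>x > 0\<close>
    by (auto intro!: derivative_eq_intros simp: field_simps)
  have f_cont: "isCont f t" for t
    unfolding f_def by (intro continuous_intros)
  have f_nonneg: "f t \<ge> 0" for t
    by (simp add: f_def)
  note substitution = interval_integral_substitution_nonneg[of 0 \<infinity> g inverse f,
      OF _ _ _ _ _ _ lim0 lim_inf fg_int[folded Ioi]]
  have f_int: "set_integrable lborel (einterval (-\<infinity>) \<infinity>) f"
    by (rule substitution(1)) (auto intro!: deriv f_cont f_nonneg continuous_intros)
  have f_integral: "(LBINT t=-\<infinity>..\<infinity>. f t) = (LBINT u=0..\<infinity>. f (g u) * inverse u)"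
    by (rule substitution(2)) (auto intro!: deriv f_cont f_nonneg continuous_intros)
  show "set_integrable lborel UNIV (\<lambda>t. exp (- x * cosh t + \<alpha> * t))"
    using f_int unfolding f_def by (simp only: einterval_eq_UNIV)
  have "(LBINT t:UNIV. f t) = (LBINT u:{0<..}. f (g u) * inverse u)"
    using f_integral by (simp add: interval_lebesgue_integral_def Ioi)
  also have "\<dots> = (LBINT u:{0<..}. (2 / x) powr \<alpha> * (u powr (\<alpha> - 1) * exp (- u - x\<^sup>2 / (4 * u))))"
    by (rule set_lebesgue_integral_cong) (auto simp: fg)
  finally show "(LBINT t:UNIV. exp (- x * cosh t + \<alpha> * t)) = (2 / x) powr \<alpha> * gaussian_mixture \<alpha> x"
    by (simp add: f_def gaussian_mixture_def)
qed

text \<open>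
  As \<open>cosh (\<alpha> * t)\<close> is the even part of \<open>exp (\<alpha> * t)\<close> and \<open>exp (- x * cosh t)\<close> is even, the integral over
  the half line is half of the integral of \<open>exp (- x * cosh t + \<alpha> * t)\<close> over the whole line.
\<close>

lemma bessel_K_eq_gaussian_mixture:
  assumes "x > 0" "\<alpha> > 0"
  shows "bessel_K \<alpha> x = (2 / x) powr \<alpha> / 2 * gaussian_mixture \<alpha> x"
proof -
  define f where "f t = exp (- x * cosh t + \<alpha> * t)" for t
  have f_int: "set_integrable lborel UNIV f"
    unfolding f_def by (rule set_integrable_exp_cosh[OF assms])
  then have int_pos: "set_integrable lborel {0..} f" and int_neg: "set_integrable lborel {..<0} f"
    by (auto elim: set_integrable_subset)
  have int_refl: "set_integrable lborel {0..} (\<lambda>t. f (- t))"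
  proof -
    have "integrable lborel (\<lambda>t. f (- t))"
      using lborel_integrable_real_affine[of f "-1" 0] f_int by (simp add: set_integrable_def)
    then have "set_integrable lborel UNIV (\<lambda>t. f (- t))"
      by (simp add: set_integrable_def)
    then show ?thesis
      by (rule set_integrable_subset) auto
  qed
  have refl: "(LBINT t:{..<0}. f t) = (LBINT t:{0..}. f (- t))"
  proof -
    have "(LBINT t:{..<0}. f t) = (LBINT t:{..0}. f t)"
      by (rule set_integral_discrete_difference[where X = "{0}"]) auto
    also have "\<dots> = (LBINT t:{0..}. f (- t))"
      by (subst set_integral_reflect) (simp add: atLeast_def)
    finally show ?thesis .
  qed
  have "exp (- x * cosh t) * cosh (\<alpha> * t) = (f t + f (- t)) / 2" for t
    by (simp add: f_def cosh_field_def exp_add[symmetric] exp_add field_simps)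
  then have "bessel_K \<alpha> x = (LBINT t:{0..}. (f t + f (- t)) / 2)"
    by (simp only: bessel_K_def)
  also have "\<dots> = ((LBINT t:{0..}. f t) + (LBINT t:{0..}. f (- t))) / 2"
    using int_pos int_refl by simp
  also have "(LBINT t:{0..}. f t) + (LBINT t:{0..}. f (- t)) = (LBINT t:{0..} \<union> {..<0}. f t)"
    using int_pos int_neg by (subst set_integral_Un) (auto simp: refl)
  also have "{0..} \<union> {..<0} = (UNIV :: real set)"
    by auto
  finally show ?thesis
    by (simp only: f_def integral_exp_cosh[OF assms] times_divide_eq_left)
qed

lemma even_power_bessel_K_eq_gaussian_mixture:
  assumes "\<alpha> > 0"
  shows "even_power_bessel_K \<alpha> x = 2 powr (\<alpha> - 1) * gaussian_mixture \<alpha> x"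
proof (cases "x = 0")
  case True
  then show ?thesis
    using gaussian_mixture_0[OF assms] by (simp add: even_power_bessel_K_def)
next
  case False
  then have "\<bar>x\<bar> powr \<alpha> * (2 / \<bar>x\<bar>) powr \<alpha> / 2 = 2 powr (\<alpha> - 1)"
    by (simp add: powr_divide powr_diff)
  moreover have "gaussian_mixture \<alpha> \<bar>x\<bar> = gaussian_mixture \<alpha> x"
    by (simp add: gaussian_mixture_def)
  ultimately show ?thesis
    using False bessel_K_eq_gaussian_mixture[of "\<bar>x\<bar>" \<alpha>] assms
    by (simp add: even_power_bessel_K_def mult.assoc flip: \<open>_ = 2 powr (\<alpha> - 1)\<close>)
qed

section \<open>Strict positive definiteness\<close>

text \<open>
  The quadratic form is a finite sum, so it moves under the integral over \<open>u\<close>, where the integrand is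
  the positive weight \<open>u powr (\<alpha> - 1) * exp (- u)\<close> times the quadratic form of the Gaussian with
  parameter \<open>c = 1 / (4 * u)\<close>. Strictness for every single \<open>u\<close> carries over to the integral.
\<close>

lemma gaussian_mixture_quadratic_form_pos:
  fixes x a :: "'i \<Rightarrow> real"
  assumes "\<alpha> > 0" "finite S" "inj_on x S" "j \<in> S" "a j \<noteq> 0"
  shows "(\<Sum>i\<in>S. \<Sum>k\<in>S. a i * a k * gaussian_mixture \<alpha> (x i - x k)) > 0"
proof -
  let ?h = "\<lambda>d u. u powr (\<alpha> - 1) * exp (- u - d\<^sup>2 / (4 * u))"
  let ?q = "\<lambda>u. \<Sum>i\<in>S. \<Sum>k\<in>S. a i * a k * ?h (x i - x k) u"
  have h_int: "integrable lborel (\<lambda>u. a i * a k * (indicator {0<..} u *\<^sub>R ?h (x i - x k) u))" for i k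
    using set_integrable_gaussian_mixture[OF \<open>\<alpha> > 0\<close>, of "x i - x k"]
    by (simp only: set_integrable_def integrable_mult_right)
  have q_indicator: "indicator {0<..} u *\<^sub>R ?q u =
      (\<Sum>i\<in>S. \<Sum>k\<in>S. a i * a k * (indicator {0<..} u *\<^sub>R ?h (x i - x k) u))" for u
    by (simp add: sum_distrib_left mult_ac)
  have "set_integrable lborel {0<..} ?q"
    unfolding set_integrable_def q_indicator by (intro Bochner_Integration.integrable_sum h_int)
  moreover have "?q u > 0" if "u > 0" for u
  proof -
    have "?q u = u powr (\<alpha> - 1) * exp (- u) *
        (\<Sum>i\<in>S. \<Sum>k\<in>S. a i * a k * exp (- (1 / (4 * u)) * (x i - x k)\<^sup>2))"
      by (simp add: sum_distrib_left exp_diff exp_minus field_simps)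
    also have "\<dots> > 0"
      using that gaussian_strictly_positive_definite[of S x "1 / (4 * u)" j a] assms
      by (intro mult_pos_pos) auto
    finally show ?thesis .
  qed
  ultimately have "(LBINT u:{0<..}. ?q u) > 0"
    by (rule set_integral_pos_Ioi)
  also have "(LBINT u:{0<..}. ?q u) = (\<Sum>i\<in>S. \<Sum>k\<in>S. a i * a k * gaussian_mixture \<alpha> (x i - x k))"
    unfolding gaussian_mixture_def set_lebesgue_integral_def q_indicator
    by (simp only: Bochner_Integration.integral_sum Bochner_Integration.integrable_sum h_int
        integral_mult_right_zero)
  finally show ?thesis .
qed

theorem theorem4:
  fixes \<alpha> :: real
  assumes "\<alpha> > 0"
  shows "strictly_positive_definite (\<lambda>x. complex_of_real (even_power_bessel_K \<alpha> x))"
proof (rule strictly_positive_definite_of_real)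
  have eq: "even_power_bessel_K \<alpha> = (\<lambda>x. 2 powr (\<alpha> - 1) * gaussian_mixture \<alpha> x)"
    using even_power_bessel_K_eq_gaussian_mixture[OF assms] by blast
  show "continuous_on UNIV (even_power_bessel_K \<alpha>)"
    unfolding eq by (intro continuous_intros continuous_gaussian_mixture assms)
  show "even_power_bessel_K \<alpha> (- x) = even_power_bessel_K \<alpha> x" for x
    by (simp add: even_power_bessel_K_def)
  show "(\<Sum>i\<in>S. \<Sum>k\<in>S. a i * a k * even_power_bessel_K \<alpha> (x i - x k)) > 0"
    if "finite S" "inj_on x S" "j \<in> S" "a j \<noteq> 0" for S :: "nat set" and x a j
  proof -
    have "(\<Sum>i\<in>S. \<Sum>k\<in>S. a i * a k * even_power_bessel_K \<alpha> (x i - x k)) =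
        2 powr (\<alpha> - 1) * (\<Sum>i\<in>S. \<Sum>k\<in>S. a i * a k * gaussian_mixture \<alpha> (x i - x k))"
      by (simp add: eq sum_distrib_left mult_ac)
    then show ?thesis
      using gaussian_mixture_quadratic_form_pos[of \<alpha> S x j a] assms that by simp
  qed
qed

end
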